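(* Let $A, B$ be alphabets, let $S$ be a semigroup, and let $\varphi : A^{+} \to S$, $\psi : B^{+} \to S$ be two epimorphisms. If the fiber product $\Pi(\varphi,\psi) = \{(u,v) \in A^{+}\times B^{+} : \varphi(u) = \psi(v)\}$ is finitely generated (as a semigroup), then $S$ is idempotent-free.
   Context: For an alphabet $A$, $A^{+}$ is the free semigroup of non-empty finite words over $A$ under concatenation. "Epimorphism" means surjective homomorphism. $\Pi(\varphi,\psi)$ is a subsemigroup of the direct product $A^{+}\times B^{+}$. A semigroup $S$ is idempotent-free if there is no $e \in S$ with $e^{2} = e$. *)

theory Defs
  imports "HOL-Algebra.Group"
begin

text \<open>
  Semigroups are given by the carrier and multiplication of a HOL-Algebra monoid record, so that
  \<^const>\<open>hom\<close>, \<^const>\<open>epi\<close> and \<^const>\<open>DirProd\<close> apply to them unchanged. The unit field of the record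
  is junk: it is not required to be a unit, nor to lie in the carrier, and no property below depends
  on it. The name \<open>semigroup\<close> is taken by the type-level locale of \<^theory>\<open>HOL.Groups\<close>.
\<close>

locale carrier_semigroup =
  fixes G (structure)
  assumes m_closed: "\<lbrakk>x \<in> carrier G; y \<in> carrier G\<rbrakk> \<Longrightarrow> x \<otimes> y \<in> carrier G"
    and m_assoc: "\<lbrakk>x \<in> carrier G; y \<in> carrier G; z \<in> carrier G\<rbrakk> \<Longrightarrow> (x \<otimes> y) \<otimes> z = x \<otimes> (y \<otimes> z)"

definition idempotent_free :: "('a, 'm) monoid_scheme \<Rightarrow> bool" where
  "idempotent_free G \<longleftrightarrow> \<not> (\<exists>e \<in> carrier G. e \<otimes>\<^bsub>G\<^esub> e = e)"

text \<open>The closure of \<open>X\<close> under products of one or more factors; no empty product is included.\<close>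

inductive_set semigroup_generate :: "('a, 'm) monoid_scheme \<Rightarrow> 'a set \<Rightarrow> 'a set"
  for G and X where
  incl: "x \<in> X \<Longrightarrow> x \<in> semigroup_generate G X"
| mult: "\<lbrakk>x \<in> semigroup_generate G X; y \<in> semigroup_generate G X\<rbrakk>
    \<Longrightarrow> x \<otimes>\<^bsub>G\<^esub> y \<in> semigroup_generate G X"

definition finitely_generated_semigroup :: "('a, 'm) monoid_scheme \<Rightarrow> bool" where
  "finitely_generated_semigroup G \<longleftrightarrow>
    (\<exists>X. finite X \<and> X \<subseteq> carrier G \<and> semigroup_generate G X = carrier G)"

definition free_semigroup :: "'a set \<Rightarrow> 'a list monoid" where
  "free_semigroup A = \<lparr>carrier = {w. w \<noteq> [] \<and> set w \<subseteq> A}, mult = (@), one = undefined\<rparr>"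

definition fiber_product ::
  "('a, 'm) monoid_scheme \<Rightarrow> ('b, 'n) monoid_scheme \<Rightarrow> ('a \<Rightarrow> 's) \<Rightarrow> ('b \<Rightarrow> 's) \<Rightarrow> ('a \<times> 'b) monoid"
  where "fiber_product G H \<phi> \<psi> =
    (G \<times>\<times> H)\<lparr>carrier := {(u, v). u \<in> carrier G \<and> v \<in> carrier H \<and> \<phi> u = \<psi> v}\<rparr>"

lemma carrier_semigroup_free_semigroup: "carrier_semigroup (free_semigroup A)"
  by unfold_locales (auto simp: free_semigroup_def)

lemma carrier_semigroup_fiber_product:
  assumes "carrier_semigroup G" "carrier_semigroup H" "\<phi> \<in> hom G S" "\<psi> \<in> hom H S"
  shows "carrier_semigroup (fiber_product G H \<phi> \<psi>)"
  using assms
  by (auto simp: carrier_semigroup_def fiber_product_def DirProd_def hom_def)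

end

theory Submission
  imports Defs
begin

text \<open>
  In a product of generators of a subsemigroup of \<open>A\<^sup>+ \<times> B\<^sup>+\<close> each factor lengthens the first
  component by at least one letter. With finitely many generators each factor lengthens the
  second component by a bounded amount, so on the whole subsemigroup the length of the second
  component is at most a constant multiple of the length of the first
  (\<open>second_length_linear_in_first\<close>). An idempotent \<open>e\<close> of \<open>S\<close> breaks such a bound on the fiber
  product: if \<open>\<phi>(u) = e = \<psi>(v)\<close>, then \<open>\<psi>\<close> sends every power of \<open>v\<close> to \<open>e\<close>
  (\<open>hom_power_of_idempotent\<close>), so the fiber product contains \<open>(u, v\<^sup>n)\<close> for every \<open>n \<ge> 1\<close>, where
  the first component is fixed and the second is arbitrarily long.
\<close>

lemma second_length_linear_in_first:
  assumes "finite X"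
    and "X \<subseteq> carrier (fiber_product (free_semigroup A) (free_semigroup B) \<phi> \<psi>)"
  shows "\<exists>K. \<forall>(x, y) \<in> semigroup_generate
           (fiber_product (free_semigroup A) (free_semigroup B) \<phi> \<psi>) X.
           length y \<le> K * length x"
proof -
  let ?P = "fiber_product (free_semigroup A) (free_semigroup B) \<phi> \<psi>"
  obtain K where K: "\<And>p. p \<in> X \<Longrightarrow> length (snd p) \<le> K"
    using finite_imageI[OF assms(1), of "\<lambda>p. length (snd p)"]
    by (auto simp: finite_nat_set_iff_bounded_le)
  have "length (snd p) \<le> K * length (fst p)" if "p \<in> semigroup_generate ?P X" for p
    using that
  proof induction
    case (incl p)
    then have "1 \<le> length (fst p)"
      using assms(2) by (auto simp: fiber_product_def free_semigroup_def Suc_le_eq)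
    then have "K * 1 \<le> K * length (fst p)"
      by (rule mult_le_mono2)
    then show ?case using K[OF incl] by linarith
  next
    case (mult p q)
    then show ?case
      by (simp add: fiber_product_def DirProd_def free_semigroup_def distrib_left case_prod_unfold)
  qed
  then show ?thesis by fastforce
qed

lemma hom_power_of_idempotent:
  assumes "\<psi> \<in> hom (free_semigroup B) S"
    and "v \<in> carrier (free_semigroup B)"
    and "\<psi> v \<otimes>\<^bsub>S\<^esub> \<psi> v = \<psi> v"
  shows "concat (replicate (Suc n) v) \<in> carrier (free_semigroup B) \<and>
    \<psi> (concat (replicate (Suc n) v)) = \<psi> v"
proof (induction n)
  case 0
  then show ?case using assms(2) by simp
next
  case (Suc n)
  let ?w = "concat (replicate (Suc n) v)"
  have "\<psi> (v \<otimes>\<^bsub>free_semigroup B\<^esub> ?w) = \<psi> v \<otimes>\<^bsub>S\<^esub> \<psi> ?w"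
    using Suc.IH assms(1,2) by (intro hom_mult) auto
  then have "\<psi> (v @ ?w) = \<psi> v"
    using Suc.IH assms(3) by (simp add: free_semigroup_def)
  moreover have "v @ ?w \<in> carrier (free_semigroup B)"
    using Suc.IH assms(2) by (simp add: free_semigroup_def)
  ultimately show ?case by simp
qed

theorem proposition4p4:
  fixes A :: "'a set" and B :: "'b set"
    and S :: "('s, 'm) monoid_scheme"
    and \<phi> :: "'a list \<Rightarrow> 's" and \<psi> :: "'b list \<Rightarrow> 's"
  assumes "carrier_semigroup S"
    and "\<phi> \<in> epi (free_semigroup A) S"
    and "\<psi> \<in> epi (free_semigroup B) S"
    and "finitely_generated_semigroup
           (fiber_product (free_semigroup A) (free_semigroup B) \<phi> \<psi>)"
  shows "idempotent_free S"
proof (rule ccontr)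
  let ?P = "fiber_product (free_semigroup A) (free_semigroup B) \<phi> \<psi>"
  assume "\<not> idempotent_free S"
  then obtain e where e: "e \<in> carrier S" "e \<otimes>\<^bsub>S\<^esub> e = e"
    by (auto simp: idempotent_free_def)
  obtain u where u: "u \<in> carrier (free_semigroup A)" "\<phi> u = e"
    using assms(2) e(1) unfolding epi_def
    by (metis (mono_tags, lifting) imageE mem_Collect_eq)
  obtain v where v: "v \<in> carrier (free_semigroup B)" "\<psi> v = e"
    using assms(3) e(1) unfolding epi_def
    by (metis (mono_tags, lifting) imageE mem_Collect_eq)
  obtain X where X: "finite X" "X \<subseteq> carrier ?P" "semigroup_generate ?P X = carrier ?P"
    using assms(4) by (auto simp: finitely_generated_semigroup_def)
  obtain K where K: "\<And>x y. (x, y) \<in> carrier ?P \<Longrightarrow> length y \<le> K * length x"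
    using second_length_linear_in_first[OF X(1,2)] X(3) by fastforce
  \<comment> \<open>As \<open>v\<close> has at least one letter, this exponent already exceeds the bound over \<open>u\<close>.\<close>
  let ?w = "concat (replicate (Suc (K * length u)) v)"
  have "?w \<in> carrier (free_semigroup B) \<and> \<psi> ?w = \<psi> v"
    using assms(3) v e(2) by (intro hom_power_of_idempotent) (auto simp: epi_def)
  then have "(u, ?w) \<in> carrier ?P"
    using u v(2) by (auto simp: fiber_product_def)
  then have "length ?w \<le> K * length u"
    by (rule K)
  moreover have "Suc (K * length u) * 1 \<le> Suc (K * length u) * length v"
    using v(1) by (intro mult_le_mono2) (simp add: free_semigroup_def Suc_le_eq)
  ultimately show False
    by (simp add: length_concat sum_list_replicate)
qed

end
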